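(* For every positive integer $n$ there is a bijection $\varphi:\mathcal{C}_{n+1}\to\mathcal{S}_n$ such that if $\pi\in\mathcal{C}_{n+1}$ and $\sigma=\varphi(\pi)$, then $$D(\pi)\cap[n-1]=D(\sigma).$$
   Context: $[n]=\{1,2,\dots,n\}$; $\mathcal{S}_n$ is the set of permutations of $[n]$; $\mathcal{C}_n\subseteq\mathcal{S}_n$ is the set of permutations consisting of one single cycle of length $n$. For $\pi\in\mathcal{S}_n$, the descent set is $D(\pi)=\{i : 1\le i\le n-1,\ \pi(i)>\pi(i+1)\}$. *)

theory Defs
  imports "HOL-Combinatorics.Orbits"
begin

text \<open>A permutation of \<open>{1..n}\<close> is a function on \<open>nat\<close> that is the identity outside \<open>{1..n}\<close>,
  so equality of functions is equality of permutations.\<close>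

definition perms :: "nat \<Rightarrow> (nat \<Rightarrow> nat) set" where
  "perms n = {\<pi>. \<pi> permutes {1..n}}"

definition cyclic_perms :: "nat \<Rightarrow> (nat \<Rightarrow> nat) set" where
  "cyclic_perms n = {\<pi> \<in> perms n. cyclic_on \<pi> {1..n}}"

text \<open>The size \<open>n\<close> is a parameter because \<open>\<pi>\<close>, as a function on \<open>nat\<close>, does not determine it.\<close>

definition descent_set :: "nat \<Rightarrow> (nat \<Rightarrow> nat) \<Rightarrow> nat set" where
  "descent_set n \<pi> = {i. 1 \<le> i \<and> i \<le> n - 1 \<and> \<pi> i > \<pi> (i + 1)}"

end

theory Submission
  imports Defs "HOL-Library.List_Lexorder" "HOL-Library.Multiset"
begin

text \<open>By inclusion--exclusion it suffices to count, for each \<open>S \<subseteq> {1..n - 1}\<close>, the permutations whose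
  descents lie in \<open>S\<close>. Let \<open>b i\<close> be the index of the block containing \<open>i\<close> when \<open>{1..n + 1}\<close> is cut
  after the elements of \<open>S \<union> {n}\<close>; the condition says that the permutation is increasing on the
  blocks inside \<open>{1..n}\<close>. Both counts equal the number of words \<open>b \<circ> x\<close> with \<open>x\<close> a permutation
  of \<open>{1..n}\<close>. For \<open>\<sigma>\<close> take \<open>x = \<sigma>\<inverse>\<close>: then \<open>x\<close> is the stable sort of its word. For a cycle
  \<open>\<pi>\<close> take \<open>x j = \<pi>\<^sup>j (n + 1)\<close>: then \<open>x\<close> sorts the positions of its word by the lexicographic order of
  the suffixes. This is the Gessel--Reutenauer correspondence between cycles and primitive necklaces,
  for necklaces that contain one letter exactly once.\<close>

section \<open>Bijections from equal fibre counts\<close>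

text \<open>Fibres of \<open>f\<close> and \<open>g\<close> over the same value are finite of equal
  size, so a bijection \<open>h c\<close> can be chosen for each value \<open>c\<close>; these are
  glued into one map.\<close>

lemma bij_betw_fibers:
  assumes "finite A" "finite B"
    and fib: "\<And>c. card {a \<in> A. f a = c} = card {b \<in> B. g b = c}"
  shows "\<exists>\<phi>. bij_betw \<phi> A B \<and> (\<forall>a\<in>A. g (\<phi> a) = f a)"
proof -
  have "\<exists>h. bij_betw h {a \<in> A. f a = c} {b \<in> B. g b = c}" for c
    using assms by (intro finite_same_card_bij) auto
  then obtain h where h: "\<And>c. bij_betw (h c) {a \<in> A. f a = c} {b \<in> B. g b = c}"
    by metis
  define \<phi> where "\<phi> a = h (f a) a" for a
  have \<phi>: "\<phi> a \<in> B \<and> g (\<phi> a) = f a" if "a \<in> A" for a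
    using bij_betwE[OF h[of "f a"]] that by (auto simp: \<phi>_def)
  have "inj_on \<phi> A"
  proof (rule inj_onI)
    fix a a' assume a: "a \<in> A" "a' \<in> A" and eq: "\<phi> a = \<phi> a'"
    then have "f a = f a'" using \<phi> by metis
    then show "a = a'"
      using a eq bij_betw_imp_inj_on[OF h[of "f a"]] by (auto simp: \<phi>_def dest: inj_onD)
  qed
  moreover have "\<phi> ` A = B"
  proof
    show "\<phi> ` A \<subseteq> B" using \<phi> by auto
    show "B \<subseteq> \<phi> ` A"
    proof
      fix b assume "b \<in> B"
      then have "b \<in> h (g b) ` {a \<in> A. f a = g b}"
        using bij_betw_imp_surj_on[OF h[of "g b"]] by auto
      then show "b \<in> \<phi> ` A" by (force simp: \<phi>_def)
    qed
  qed
  ultimately show ?thesis using \<phi> by (auto simp: bij_betw_def)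
qed

text \<open>Isolates the fibre over \<open>S\<close> itself, so that induction over proper subsets
  can recover its size.\<close>

lemma card_subset_eq_sum_fibers:
  assumes "finite C" "finite S"
  shows "card {a \<in> C. h a \<subseteq> S} = card {a \<in> C. h a = S} + (\<Sum>T | T \<subset> S. card {a \<in> C. h a = T})"
proof -
  have fin: "finite {T. T \<subset> S}"
    by (rule finite_subset[of _ "Pow S"]) (use assms(2) in auto)
  have "{a \<in> C. h a \<subseteq> S} = {a \<in> C. h a = S} \<union> (\<Union>T\<in>{T. T \<subset> S}. {a \<in> C. h a = T})"
    by auto
  also have "card \<dots> = card {a \<in> C. h a = S} + card (\<Union>T\<in>{T. T \<subset> S}. {a \<in> C. h a = T})"
    using assms(1) fin by (intro card_Un_disjoint) auto
  also have "card (\<Union>T\<in>{T. T \<subset> S}. {a \<in> C. h a = T}) = (\<Sum>T | T \<subset> S. card {a \<in> C. h a = T})"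
    using assms(1) fin by (intro card_UN_disjoint) auto
  finally show ?thesis .
qed

text \<open>Moebius inversion on the subset lattice, in the form of an induction: the fibres over
  proper subsets of \<open>S\<close> agree by the induction hypothesis and cancel from both
  totals.\<close>

lemma card_fiber_eq_if_card_subset_eq:
  assumes fin: "finite A" "finite B" "finite S"
    and sub: "\<And>T. T \<subseteq> S \<Longrightarrow> card {a \<in> A. f a \<subseteq> T} = card {b \<in> B. g b \<subseteq> T}"
  shows "card {a \<in> A. f a = S} = card {b \<in> B. g b = S}"
  using fin(3) sub
proof (induction S rule: finite_psubset_induct)
  case (psubset S)
  have "(\<Sum>T | T \<subset> S. card {a \<in> A. f a = T}) = (\<Sum>T | T \<subset> S. card {b \<in> B. g b = T})"
    by (intro sum.cong refl psubset.IH psubset.prems) auto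
  then show ?case
    using card_subset_eq_sum_fibers[OF fin(1) psubset.hyps, of f]
      card_subset_eq_sum_fibers[OF fin(2) psubset.hyps, of g] psubset.prems[of S] by simp
qed

section \<open>Permutations determined by the order of keys\<close>

text \<open>The value \<open>x i\<close> is its own rank, since \<open>x\<close> maps the counted
  positions bijectively onto \<open>{1..x i}\<close>. Hence a permutation can be recovered from
  comparisons alone.\<close>

lemma permutes_eq_card_le:
  assumes "x permutes {1..n::nat}" "i \<in> {1..n}"
  shows "x i = card {j \<in> {1..n}. x j \<le> x i}"
proof -
  have "x ` {j \<in> {1..n}. x j \<le> x i} = {1..x i}"
  proof (intro equalityI subsetI)
    fix k assume "k \<in> {1..x i}"
    moreover have "x i \<in> {1..n}" using permutes_in_image[OF assms(1)] assms(2) by blast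
    ultimately have "k \<in> x ` {1..n}" using permutes_image[OF assms(1)] by auto
    with \<open>k \<in> {1..x i}\<close> show "k \<in> x ` {j \<in> {1..n}. x j \<le> x i}" by auto
  next
    fix k assume "k \<in> x ` {j \<in> {1..n}. x j \<le> x i}"
    then show "k \<in> {1..x i}" using permutes_image[OF assms(1)] by fastforce
  qed
  moreover have "inj_on x {j \<in> {1..n}. x j \<le> x i}"
    using permutes_inj[OF assms(1)] by (rule inj_on_subset) simp
  ultimately show ?thesis by (metis card_image card_atLeastAtMost diff_Suc_1)
qed

lemma permutes_eqI_order:
  assumes "x permutes {1..n::nat}" "y permutes {1..n}"
    and "\<And>i j. i \<in> {1..n} \<Longrightarrow> j \<in> {1..n} \<Longrightarrow> x i < x j \<longleftrightarrow> y i < y j"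
  shows "x = y"
proof
  fix i
  show "x i = y i"
  proof (cases "i \<in> {1..n}")
    case True
    then have "{j \<in> {1..n}. x j \<le> x i} = {j \<in> {1..n}. y j \<le> y i}"
      using assms(3) by (auto simp flip: not_less)
    then show ?thesis using permutes_eq_card_le assms(1,2) True by metis
  next
    case False
    then show ?thesis using assms(1,2) by (simp add: permutes_not_in)
  qed
qed

text \<open>The witness sends \<open>i\<close> to the rank of \<open>k i\<close> among the keys;
  injectivity of \<open>k\<close> makes the ranks distinct.\<close>

lemma ex_permutes_sorting:
  fixes k :: "nat \<Rightarrow> 'k::linorder"
  assumes "inj_on k {1..n}"
  shows "\<exists>x. x permutes {1..n} \<and> (\<forall>i\<in>{1..n}. \<forall>j\<in>{1..n}. x i < x j \<longleftrightarrow> k i < k j)"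
proof -
  define r where "r i = card {j \<in> {1..n}. k j \<le> k i}" for i
  define x where "x i = (if i \<in> {1..n} then r i else i)" for i
  have mono: "r i < r j" if "i \<in> {1..n}" "j \<in> {1..n}" "k i < k j" for i j
    unfolding r_def
  proof (rule psubset_card_mono)
    have "j \<in> {l \<in> {1..n}. k l \<le> k j} - {l \<in> {1..n}. k l \<le> k i}" using that by auto
    moreover have "{l \<in> {1..n}. k l \<le> k i} \<subseteq> {l \<in> {1..n}. k l \<le> k j}"
      using that by auto
    ultimately show "{l \<in> {1..n}. k l \<le> k i} \<subset> {l \<in> {1..n}. k l \<le> k j}" by blast
  qed simp
  have iff: "r i < r j \<longleftrightarrow> k i < k j" if "i \<in> {1..n}" "j \<in> {1..n}" for i j
    using mono[OF that] mono[OF that(2,1)] assms that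
    by (metis inj_onD less_asym less_irrefl linorder_neqE)
  have "r i \<in> {1..n}" if "i \<in> {1..n}" for i
  proof -
    have "card {j \<in> {1..n}. k j \<le> k i} \<le> card {1..n}" by (rule card_mono) auto
    moreover have "card {j \<in> {1..n}. k j \<le> k i} > 0" using that by (auto simp: card_gt_0_iff)
    ultimately show ?thesis by (simp add: r_def)
  qed
  then have "x ` {1..n} \<subseteq> {1..n}" by (auto simp: x_def)
  moreover have "inj_on x {1..n}"
    by (rule inj_onI) (metis assms iff inj_onD less_irrefl linorder_neqE x_def)
  ultimately have "bij_betw x {1..n} {1..n}"
    by (simp add: bij_betw_def endo_inj_surj)
  then have "x permutes {1..n}"
    by (rule bij_imp_permutes) (auto simp: x_def)
  then show ?thesis using iff by (auto simp: x_def)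
qed

text \<open>The value lists of \<open>f\<close> and \<open>f \<circ> p\<close> are sorted and have
  the same multiset of entries, so they coincide.\<close>

lemma mono_rearrangement_unique:
  fixes f :: "nat \<Rightarrow> 'a::linorder"
  assumes "p permutes {1..n}" "mono_on {1..n} f" "mono_on {1..n} (f \<circ> p)" "i \<in> {1..n}"
  shows "f (p i) = f i"
proof -
  have m: "mset_set {1..n} = mset [1..<Suc n]"
    by (simp only: mset_upt atLeastLessThanSuc_atLeastAtMost)
  have "mset (map (f \<circ> p) [1..<Suc n]) = image_mset f (image_mset p (mset_set {1..n}))"
    by (simp only: mset_map m image_mset.compositionality o_def)
  also have "\<dots> = mset (map f [1..<Suc n])"
    using assms(1) by (simp only: mset_map m[symmetric] image_mset_mset_set permutes_inj_on permutes_image)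
  finally have eq: "mset (map (f \<circ> p) [1..<Suc n]) = mset (map f [1..<Suc n])" .
  have sorted: "sorted (map g [1..<Suc n])" if "mono_on {1..n} g" for g :: "nat \<Rightarrow> 'a"
    unfolding sorted_map
    by (rule sorted_wrt_mono_rel[OF _ sorted_upt]) (use mono_onD[OF that] in \<open>auto simp del: upt_Suc\<close>)
  have "map f [1..<Suc n] = map (f \<circ> p) [1..<Suc n]"
    using properties_for_sort[OF eq sorted[OF assms(3)]]
      properties_for_sort[OF refl sorted[OF assms(2)]] by simp
  then have "\<forall>j\<in>set [1..<Suc n]. f j = (f \<circ> p) j" by (simp only: map_eq_conv)
  then show ?thesis using assms(4) by (simp del: upt_Suc)
qed

text \<open>Each word \<open>b \<circ> y\<close> comes from exactly one \<open>x\<close> that ranks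
  positions by the key. The key depends only on the word, and the order it induces determines
  \<open>x\<close>; conversely, ranking the keys gives back the same word because keys refine
  letters. Thus the number of such \<open>x\<close> is the same for every admissible key.\<close>

lemma bij_betw_comp_sorted_by_key:
  fixes K :: "(nat \<Rightarrow> 'a::linorder) \<Rightarrow> nat \<Rightarrow> 'k::linorder"
  assumes mono: "mono_on {1..n} b"
    and inj: "\<And>w. inj_on (K w) {1..n}"
    and refine: "\<And>w i j. i \<in> {1..n} \<Longrightarrow> j \<in> {1..n} \<Longrightarrow> w i < w j \<Longrightarrow> K w i < K w j"
  shows "bij_betw ((\<circ>) b)
    {x \<in> perms n. \<forall>i\<in>{1..n}. \<forall>j\<in>{1..n}. x i < x j \<longleftrightarrow> K (b \<circ> x) i < K (b \<circ> x) j}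
    ((\<circ>) b ` perms n)"
    (is "bij_betw _ ?X _")
proof (rule bij_betw_imageI)
  show "inj_on ((\<circ>) b) ?X"
  proof (rule inj_onI)
    fix x y assume x: "x \<in> ?X" and y: "y \<in> ?X" and eq: "b \<circ> x = b \<circ> y"
    show "x = y"
    proof (rule permutes_eqI_order)
      show "x permutes {1..n}" "y permutes {1..n}" using x y by (auto simp: perms_def)
      show "x i < x j \<longleftrightarrow> y i < y j" if "i \<in> {1..n}" "j \<in> {1..n}" for i j
      proof -
        have "x i < x j \<longleftrightarrow> K (b \<circ> x) i < K (b \<circ> x) j" using x that by blast
        moreover have "y i < y j \<longleftrightarrow> K (b \<circ> y) i < K (b \<circ> y) j" using y that by blast
        ultimately show ?thesis by (simp only: eq)
      qed
    qed
  qed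
  show "(\<circ>) b ` ?X = (\<circ>) b ` perms n"
  proof (intro equalityI subsetI)
    fix w assume "w \<in> (\<circ>) b ` perms n"
    then obtain y where y: "y permutes {1..n}" and w: "w = b \<circ> y" by (auto simp: perms_def)
    obtain x where x: "x permutes {1..n}"
      and ord: "\<And>i j. i \<in> {1..n} \<Longrightarrow> j \<in> {1..n} \<Longrightarrow> x i < x j \<longleftrightarrow> K w i < K w j"
      using ex_permutes_sorting[OF inj[of w]] by blast
    \<comment> \<open>\<open>p\<close> relabels ranks so that \<open>p (x i) = y i\<close>. The goal
      \<open>b \<circ> x = w\<close> thus amounts to \<open>b \<circ> p = b\<close>, which follows
      once \<open>b \<circ> p\<close> is known to be monotone.\<close>
    define p where "p = y \<circ> inv x"
    have p: "p permutes {1..n}"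
      unfolding p_def using x y by (intro permutes_compose permutes_inv)
    have px: "p (x i) = y i" for i
      using permutes_inverses(2)[OF x] by (simp add: p_def)
    have "mono_on {1..n} (b \<circ> p)"
    proof (rule mono_onI)
      fix r s assume rs: "r \<in> {1..n}" "s \<in> {1..n}" "r \<le> s"
      define i j where "i = inv x r" and "j = inv x s"
      have ij: "i \<in> {1..n}" "j \<in> {1..n}" "x i = r" "x j = s"
        using rs by (simp_all only: i_def j_def permutes_in_image[OF permutes_inv[OF x]] permutes_inverses(1)[OF x])
      \<comment> \<open>A smaller letter at \<open>j\<close> would give a smaller key, hence
        \<open>s < r\<close>.\<close>
      have "\<not> w j < w i" using refine[of j i w] ord[of j i] ij rs by auto
      then show "(b \<circ> p) r \<le> (b \<circ> p) s" using ij px[of i] px[of j] by (simp add: w)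
    qed
    then have "b (p r) = b r" if "r \<in> {1..n}" for r
      using mono_rearrangement_unique[OF p mono _ that] by simp
    then have "b (p r) = b r" for r
      using permutes_not_in[OF p, of r] by (cases "r \<in> {1..n}") auto
    then have "b \<circ> x = w" using px by (metis comp_apply ext w)
    moreover from this have "x \<in> ?X" using x ord by (simp add: perms_def)
    ultimately show "w \<in> (\<circ>) b ` ?X" by blast
  qed auto
qed

section \<open>Cycles as trajectories, and the suffix order\<close>

text \<open>This is cycle notation read from the element after \<open>n + 1\<close>. The default
  value at \<open>Suc n\<close> is the true one for a cycle: after \<open>n + 1\<close> steps the
  orbit is back at \<open>n + 1\<close>.\<close>

definition trajectory :: "nat \<Rightarrow> (nat \<Rightarrow> nat) \<Rightarrow> nat \<Rightarrow> nat" where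
  "trajectory n \<pi> j = (if j \<in> {1..n} then (\<pi> ^^ j) (Suc n) else j)"

text \<open>The orbit of \<open>n + 1\<close> has length \<open>n + 1\<close>, so the iterates
  \<open>1\<close> to \<open>n\<close> run once through all other elements. The step rule at
  \<open>j = n\<close> expresses the return to \<open>n + 1\<close>.\<close>

lemma
  assumes "\<pi> \<in> cyclic_perms (Suc n)"
  shows trajectory_permutes: "trajectory n \<pi> permutes {1..n}"
    and trajectory_step: "j \<in> {1..n} \<Longrightarrow> \<pi> (trajectory n \<pi> j) = trajectory n \<pi> (Suc j)"
proof -
  define d where "d = funpow_dist1 \<pi> (Suc n) (Suc n)"
  have orb: "orbit \<pi> (Suc n) = {1..Suc n}"
    using orbit_cyclic_eq3[of \<pi> "{1..Suc n}" "Suc n"] assms by (simp add: cyclic_perms_def)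
  then have self: "Suc n \<in> orbit \<pi> (Suc n)" by simp
  have img: "{1..Suc n} = (\<lambda>k. (\<pi> ^^ k) (Suc n)) ` {0..<d}"
    using orbit_conv_funpow_dist1[OF self] orb by (simp add: d_def)
  have inj: "inj_on (\<lambda>k. (\<pi> ^^ k) (Suc n)) {0..<d}"
    unfolding d_def by (rule inj_on_funpow_dist1[OF self])
  have d: "d = Suc n" using card_image[OF inj] unfolding img[symmetric] by simp
  have "{1..n} = {0..<d} - {0}" by (auto simp: d)
  then have "(\<lambda>k. (\<pi> ^^ k) (Suc n)) ` {1..n} = {1..Suc n} - {Suc n}"
    using inj_on_image_set_diff[OF inj, of "{0..<d}" "{0}"] unfolding img by (simp add: d)
  also have "\<dots> = {1..n}" by auto
  finally have "bij_betw (\<lambda>k. (\<pi> ^^ k) (Suc n)) {1..n} {1..n}"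
    using inj_on_subset[OF inj, of "{1..n}"] by (simp add: bij_betw_def d subset_eq)
  then have "bij_betw (trajectory n \<pi>) {1..n} {1..n}"
    by (subst bij_betw_cong) (auto simp: trajectory_def)
  then show "trajectory n \<pi> permutes {1..n}"
    by (rule bij_imp_permutes) (auto simp: trajectory_def)
  have "(\<pi> ^^ Suc n) (Suc n) = Suc n"
    using funpow_dist1_prop[OF self] by (simp only: d_def[symmetric] d)
  then show "\<pi> (trajectory n \<pi> j) = trajectory n \<pi> (Suc j)" if "j \<in> {1..n}"
    using that by (cases "j = n") (auto simp: trajectory_def)
qed

text \<open>Once a cycle is written with \<open>n + 1\<close> last, the remaining entries may stand
  in any order, and they determine the cycle.\<close>

lemma bij_betw_trajectory:
  assumes "n \<ge> 1"
  shows "bij_betw (trajectory n) (cyclic_perms (Suc n)) (perms n)"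
proof (rule bij_betw_imageI)
  show "inj_on (trajectory n) (cyclic_perms (Suc n))"
  proof (rule inj_onI)
    fix \<pi> \<rho> assume \<pi>: "\<pi> \<in> cyclic_perms (Suc n)" and \<rho>: "\<rho> \<in> cyclic_perms (Suc n)"
      and eq: "trajectory n \<pi> = trajectory n \<rho>"
    show "\<pi> = \<rho>"
    proof
      fix k
      consider "k \<in> {1..n}" | "k = Suc n" | "k \<notin> {1..Suc n}" by fastforce
      then show "\<pi> k = \<rho> k"
      proof cases
        case 1
        then obtain j where "j \<in> {1..n}" "k = trajectory n \<pi> j"
          using permutes_image[OF trajectory_permutes[OF \<pi>]] by blast
        then show ?thesis using trajectory_step[OF \<pi>, of j] trajectory_step[OF \<rho>, of j] eq by simp
      next
        \<comment> \<open>The image of \<open>n + 1\<close> is the first entry of the trajectory,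
          which exists as \<open>n \<ge> 1\<close>.\<close>
        case 2
        then show ?thesis using fun_cong[OF eq, of 1] assms by (simp add: trajectory_def)
      next
        case 3
        moreover have "\<pi> permutes {1..Suc n}" "\<rho> permutes {1..Suc n}"
          using \<pi> \<rho> by (simp_all add: cyclic_perms_def perms_def)
        ultimately show ?thesis using permutes_not_in by metis
      qed
    qed
  qed
  show "trajectory n ` cyclic_perms (Suc n) = perms n"
  proof (intro equalityI subsetI)
    fix x assume "x \<in> trajectory n ` cyclic_perms (Suc n)"
    then show "x \<in> perms n" using trajectory_permutes by (auto simp: perms_def)
  next
    fix x assume "x \<in> perms n"
    then have x: "x permutes {1..n}" by (simp add: perms_def)
    then have x': "x permutes {1..Suc n}" by (rule permutes_subset) auto
    have xN: "x (Suc n) = Suc n" using x by (simp add: permutes_not_in)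
    \<comment> \<open>\<open>c\<close> is the standard cycle on \<open>{1..Suc n}\<close>;
      conjugating it by \<open>x\<close> gives the cycle that visits \<open>x 1\<close>, ...,
      \<open>x n\<close>, \<open>Suc n\<close> in turn.\<close>
    define c where "c j = (if j \<in> {1..n} then Suc j else if j = Suc n then 1 else j)" for j
    have "bij_betw c {1..Suc n} {1..Suc n}"
    proof (rule bij_betw_imageI)
      show "inj_on c {1..Suc n}" by (auto simp: inj_on_def c_def)
      then show "c ` {1..Suc n} = {1..Suc n}"
        by (intro endo_inj_surj) (auto simp: c_def)
    qed
    then have c: "c permutes {1..Suc n}"
      by (rule bij_imp_permutes) (auto simp: c_def)
    define \<pi> where "\<pi> = x \<circ> c \<circ> inv x"
    have \<pi>: "\<pi> permutes {1..Suc n}"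
      unfolding \<pi>_def by (intro permutes_compose permutes_inv x' c)
    have \<pi>x: "\<pi> (x j) = x (c j)" for j
      using permutes_inverses(2)[OF x] by (simp add: \<pi>_def)
    have pow: "(\<pi> ^^ Suc j) (Suc n) = x (Suc j)" if "j \<le> n" for j
      using that
    proof (induction j)
      case 0
      then show ?case using \<pi>x[of "Suc n"] xN by (simp add: c_def)
    next
      case (Suc j)
      then show ?case using \<pi>x[of "Suc j"] by (simp add: c_def)
    qed
    have "orbit \<pi> (Suc n) = {1..Suc n}"
    proof
      show "orbit \<pi> (Suc n) \<subseteq> {1..Suc n}" by (rule permutes_orbit_subset[OF \<pi>]) simp
      show "{1..Suc n} \<subseteq> orbit \<pi> (Suc n)"
      proof
        fix k assume "k \<in> {1..Suc n}"
        then obtain j where "j \<in> {1..Suc n}" "k = x j"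
          using permutes_image[OF x'] by blast
        then have "k = (\<pi> ^^ j) (Suc n)" "j > 0" using pow[of "j - 1"] by auto
        then show "k \<in> orbit \<pi> (Suc n)" unfolding orbit_altdef by blast
      qed
    qed
    then have "cyclic_on \<pi> {1..Suc n}" by (intro cyclic_on_singleI[of "Suc n"]) simp_all
    then have "\<pi> \<in> cyclic_perms (Suc n)" using \<pi> by (simp add: cyclic_perms_def perms_def)
    moreover have "trajectory n \<pi> = x"
    proof
      fix j
      show "trajectory n \<pi> j = x j"
        using pow permutes_not_in[OF x, of j] by (cases j) (auto simp: trajectory_def)
    qed
    ultimately show "x \<in> trajectory n ` cyclic_perms (Suc n)" by blast
  qed
qed

text \<open>The words \<open>K w i = w\<^sub>i \<dots> w\<^sub>n w\<^sub>n\<^sub>+\<^sub>1\<close> are compared lexicographically. None is a prefix of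
  another, because the maximal letter occurs only at their ends.\<close>

lemma suffix_order_iff:
  fixes w x :: "nat \<Rightarrow> nat" and n :: nat
  defines "K \<equiv> \<lambda>i. map w [i..<n + 2]"
  assumes x: "x permutes {1..n}"
    and mono: "\<And>i j. i \<in> {1..Suc n} \<Longrightarrow> j \<in> {1..Suc n} \<Longrightarrow> x i < x j \<Longrightarrow> w i \<le> w j"
    and max: "\<And>i. i \<in> {1..n} \<Longrightarrow> w i < w (Suc n)"
  shows "(\<forall>i\<in>{1..n}. \<forall>j\<in>{1..n}. x i < x j \<longrightarrow> w i = w j \<longrightarrow> x (Suc i) < x (Suc j)) \<longleftrightarrow>
    (\<forall>i\<in>{1..n}. \<forall>j\<in>{1..n}. x i < x j \<longleftrightarrow> K i < K j)"
    (is "?L \<longleftrightarrow> ?R")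
proof -
  have xN: "x (Suc n) = Suc n" using x by (simp add: permutes_not_in)
  have x_le: "x i \<in> {1..n}" if "i \<in> {1..n}" for i
    using permutes_in_image[OF x] that by blast
  have K: "K i = w i # K (Suc i)" if "i \<in> {1..Suc n}" for i
    using that unfolding K_def by (subst upt_conv_Cons) auto
  have KN: "K (Suc (Suc n)) = []" by (simp add: K_def)
  have inj: "x i = x j \<longleftrightarrow> i = j" for i j using permutes_inj[OF x] by (auto dest: injD)
  show ?thesis
  proof
    assume L: ?L
    \<comment> \<open>Induction on the length of the suffix at \<open>i\<close>: different first
      letters decide by \<open>mono\<close>, and equal ones are stripped, with \<open>?L\<close>
      carrying the inequality to the next positions.\<close>
    have lt: "K i < K j" if "i \<in> {1..Suc n}" "j \<in> {1..Suc n}" "x i < x j" for i j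
      using that
    proof (induction "Suc n - i" arbitrary: i j rule: less_induct)
      case less
      have i: "i \<in> {1..n}"
        using less.prems x_le[of j] xN by (cases "i = Suc n"; cases "j = Suc n") auto
      show ?case
      proof (cases "w i = w j")
        case True
        then have j: "j \<in> {1..n}" using max[OF i] less.prems(2) by (cases "j = Suc n") auto
        have "K (Suc i) < K (Suc j)"
          using i j L True less.prems(3) by (intro less.hyps) auto
        then show ?thesis using K[of i] K[of j] True less.prems by simp
      next
        case False
        then show ?thesis using K[of i] K[of j] mono[of i j] less.prems by simp
      qed
    qed
    show ?R
    proof (intro ballI)
      fix i j assume ij: "i \<in> {1..n}" "j \<in> {1..n}"
      then show "x i < x j \<longleftrightarrow> K i < K j"
        using lt[of i j] lt[of j i] inj[of i j] by (cases "x i" "x j" rule: linorder_cases) auto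
    qed
  next
    assume R: ?R
    show ?L
    proof (intro ballI impI)
      fix i j assume ij: "i \<in> {1..n}" "j \<in> {1..n}" "x i < x j" "w i = w j"
      then have lt: "K (Suc i) < K (Suc j)" using R K[of i] K[of j] by fastforce
      \<comment> \<open>At the boundary, \<open>i = n\<close> would make the one-letter word with
        the maximal letter smaller than a suffix starting with a lesser letter, while for
        \<open>j = n\<close> the value \<open>x (Suc j) = Suc n\<close> exceeds every other.\<close>
      consider "i = n" | "i < n" "j = n" | "i < n" "j < n" using ij by fastforce
      then show "x (Suc i) < x (Suc j)"
      proof cases
        case 1
        then have "j < n" using ij by (cases "j = n") auto
        then have False
          using lt 1 K[of "Suc i"] K[of "Suc j"] KN max[of "Suc j"] by auto
        then show ?thesis ..
      next
        case 2
        then show ?thesis using xN x_le[of "Suc i"] ij by auto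
      next
        case 3
        then show ?thesis using R lt by auto
      qed
    qed
  qed
qed

section \<open>Counting permutations by their descents\<close>

text \<open>\<open>b S i\<close> is the number of cuts before \<open>i\<close>, that is, the index
  of its block. Neighbours in one block are not separated by an element of \<open>S\<close>, so
  absence of descents there propagates by transitivity along the block.\<close>

lemma no_descents_outside_iff:
  fixes f :: "nat \<Rightarrow> nat" and n :: nat
  defines "b \<equiv> \<lambda>S i. card {s \<in> insert n S. s < i}"
  assumes inj: "inj_on f {1..n}" and S: "S \<subseteq> {1..n - 1}"
  shows "{i \<in> {1..n - 1}. f i > f (i + 1)} \<subseteq> S \<longleftrightarrow>
    (\<forall>p\<in>{1..n}. \<forall>q\<in>{1..n}. p < q \<longrightarrow> b S p = b S q \<longrightarrow> f p < f q)"
    (is "?L \<longleftrightarrow> ?R")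
proof
  have fin: "finite S" using S finite_subset by blast
  have b_mono: "b S i \<le> b S j" if "i \<le> j" for i j
    using that fin unfolding b_def by (auto intro!: card_mono)
  assume L: ?L
  have "f p < f q" if "p \<ge> 1" "Suc p \<le> q" "q \<le> n" "b S p = b S q" for p q
    using that(2,3,4)
  proof (induction q rule: dec_induct)
    case base
    \<comment> \<open>Nested finite sets of equal size are equal, so \<open>p\<close> is no
      cut.\<close>
    have "{s \<in> insert n S. s < p} = {s \<in> insert n S. s < Suc p}"
      using base(2) fin unfolding b_def by (intro card_subset_eq) auto
    then have "p \<notin> S" by auto
    then have "\<not> f p > f (Suc p)" using L that(1) base by auto
    moreover have "f p \<noteq> f (Suc p)" using inj that(1) base by (auto simp: inj_on_eq_iff)
    ultimately show ?case by simp
  next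
    case (step q)
    have "b S p \<le> b S q" "b S q \<le> b S (Suc q)"
      using step.hyps by (auto intro!: b_mono)
    then have eq: "b S p = b S q" "b S q = b S (Suc q)" using step by auto
    have "{s \<in> insert n S. s < q} = {s \<in> insert n S. s < Suc q}"
      using eq(2) fin unfolding b_def by (intro card_subset_eq) auto
    then have "q \<notin> S" by auto
    moreover have "q \<in> {1..n - 1}" using that(1) step.hyps step.prems by auto
    ultimately have "\<not> f q > f (Suc q)" using L by auto
    then show ?case using step eq by simp
  qed
  then show ?R by auto
next
  assume R: ?R
  show ?L
  proof
    fix i assume "i \<in> {i \<in> {1..n - 1}. f i > f (i + 1)}"
    then have i: "i \<in> {1..n - 1}" "f i > f (Suc i)" by auto
    show "i \<in> S"
    proof (rule ccontr)
      assume "i \<notin> S"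
      then have "{s \<in> insert n S. s < i} = {s \<in> insert n S. s < Suc i}"
        using i by (auto simp: less_Suc_eq)
      then have "b S i = b S (Suc i)" by (simp add: b_def)
      moreover have "i \<in> {1..n}" "Suc i \<in> {1..n}" using i by auto
      ultimately have "f i < f (Suc i)" using R by blast
      with i show False by simp
    qed
  qed
qed

text \<open>\<open>trajectory n\<close> carries the cycles to \<open>X K1\<close> and inversion
  carries the permutations to \<open>X K2\<close>; both sets have as many elements as there are
  words \<open>b \<circ> x\<close>.\<close>

lemma card_descents_subset_eq:
  assumes n: "n \<ge> 1" and S: "S \<subseteq> {1..n - 1}"
  shows "card {\<pi> \<in> cyclic_perms (Suc n). descent_set (Suc n) \<pi> \<inter> {1..n - 1} \<subseteq> S} =
    card {\<sigma> \<in> perms n. descent_set n \<sigma> \<subseteq> S}"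
    (is "card ?A = card ?B")
proof -
  define b where "b i = card {s \<in> insert n S. s < i}" for i
  note nd = no_descents_outside_iff[OF _ S, folded b_def]
  have fin: "finite S" using S finite_subset by blast
  have b_mono: "b i \<le> b j" if "i \<le> j" for i j
    using that fin unfolding b_def by (auto intro!: card_mono)
  \<comment> \<open>The cut after \<open>n\<close> gives \<open>n + 1\<close> a block of its own,
    hence a letter above all others.\<close>
  have b_max: "b i < b (Suc n)" if "i \<in> {1..n}" for i
    unfolding b_def
  proof (rule psubset_card_mono)
    have "n \<in> {s \<in> insert n S. s < Suc n} - {s \<in> insert n S. s < i}" using that by simp
    moreover have "{s \<in> insert n S. s < i} \<subseteq> {s \<in> insert n S. s < Suc n}"
      using that by (auto simp del: insert_iff)
    ultimately show "{s \<in> insert n S. s < i} \<subset> {s \<in> insert n S. s < Suc n}" by blast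
  qed (use fin in simp)
  \<comment> \<open>\<open>K1\<close> is the suffix up to and including position
    \<open>n + 1\<close>. \<open>K2\<close> breaks ties by position, as stable sorting does; it is
    written as a list so that both keys have the type required by \<open>X\<close>.\<close>
  define K1 where "K1 w i = map w [i..<n + 2]" for w :: "nat \<Rightarrow> nat" and i
  define K2 where "K2 w i = [w i, i]" for w :: "nat \<Rightarrow> nat" and i
  define X where "X K = {x \<in> perms n. \<forall>i\<in>{1..n}. \<forall>j\<in>{1..n}.
    x i < x j \<longleftrightarrow> K (b \<circ> x) i < K (b \<circ> x) j}" for K :: "(nat \<Rightarrow> nat) \<Rightarrow> nat \<Rightarrow> nat list"
  have mono: "mono_on {1..n} b"
    by (rule mono_onI) (rule b_mono)
  have X: "card (X K) = card ((\<circ>) b ` perms n)"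
    if "\<And>w. inj_on (K w) {1..n}"
      "\<And>w i j. i \<in> {1..n} \<Longrightarrow> j \<in> {1..n} \<Longrightarrow> w i < w j \<Longrightarrow> K w i < K w j" for K
    unfolding X_def by (rule bij_betw_same_card[OF bij_betw_comp_sorted_by_key[of n b K, OF mono that]])
  have "card (X K1) = card ((\<circ>) b ` perms n)"
  proof (rule X)
    show "inj_on (K1 w) {1..n}" for w
    proof (rule inj_onI)
      fix i j assume ij: "i \<in> {1..n}" "j \<in> {1..n}" "K1 w i = K1 w j"
      then have "length (K1 w i) = length (K1 w j)" by simp
      then show "i = j" using ij(1,2) by (auto simp: K1_def simp del: upt_Suc)
    qed
    have "K1 w i = w i # map w [Suc i..<n + 2]" if "i \<in> {1..n}" for w i
      unfolding K1_def using that by (subst upt_conv_Cons) auto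
    then show "K1 w i < K1 w j" if "i \<in> {1..n}" "j \<in> {1..n}" "w i < w j" for w i j
      using that by simp
  qed
  also have "\<dots> = card (X K2)"
  proof (rule X[symmetric])
    show "inj_on (K2 w) {1..n}" for w by (simp add: K2_def inj_on_def)
    show "K2 w i < K2 w j" if "w i < w j" for w i j using that by (simp add: K2_def)
  qed
  also have "\<dots> = card ?B"
  proof (rule bij_betw_same_card[OF bij_betw_byWitness[where f = inv and f' = inv]])
    have inv_iff: "inv x \<in> ?B \<longleftrightarrow> x \<in> X K2" if "x \<in> perms n" for x
    proof -
      have x: "x permutes {1..n}" using that by (simp add: perms_def)
      have "descent_set n (inv x) = {i \<in> {1..n - 1}. inv x i > inv x (i + 1)}"
        by (auto simp: descent_set_def)
      moreover have "inv x \<in> perms n" using permutes_inv[OF x] by (simp add: perms_def)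
      ultimately have "inv x \<in> ?B \<longleftrightarrow> {i \<in> {1..n - 1}. inv x i > inv x (i + 1)} \<subseteq> S" by simp
      \<comment> \<open>Writing the range as an image of \<open>x\<close> allows the substitution
        \<open>p = x i\<close>, \<open>q = x j\<close>, under which \<open>inv x\<close> returns the
        indices.\<close>
      also have "\<dots> \<longleftrightarrow> (\<forall>p\<in>x ` {1..n}. \<forall>q\<in>x ` {1..n}. p < q \<longrightarrow> b p = b q \<longrightarrow> inv x p < inv x q)"
        unfolding permutes_image[OF x] by (rule nd[OF permutes_inj_on[OF permutes_inv[OF x]]])
      also have "\<dots> \<longleftrightarrow> (\<forall>i\<in>{1..n}. \<forall>j\<in>{1..n}. x i < x j \<longrightarrow> b (x i) = b (x j) \<longrightarrow> i < j)"
        by (simp add: permutes_inverses(2)[OF x])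
      also have "\<dots> \<longleftrightarrow> (\<forall>i\<in>{1..n}. \<forall>j\<in>{1..n}. x i < x j \<longleftrightarrow> K2 (b \<circ> x) i < K2 (b \<circ> x) j)"
        (is "?L \<longleftrightarrow> ?R")
      proof
        assume L: ?L
        \<comment> \<open>As \<open>b\<close> is monotone, \<open>x i < x j\<close> already orders
          the letters weakly, so only ties depend on \<open>?L\<close>.\<close>
        have lt: "K2 (b \<circ> x) i < K2 (b \<circ> x) j" if "i \<in> {1..n}" "j \<in> {1..n}" "x i < x j" for i j
        proof (cases "b (x i) = b (x j)")
          case True
          then have "i < j" using L that by blast
          then show ?thesis using True by (simp add: K2_def)
        next
          case False
          then show ?thesis using b_mono[of "x i" "x j"] that(3) by (simp add: K2_def)
        qed
        show ?R
        proof (intro ballI)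
          fix i j assume "i \<in> {1..n}" "j \<in> {1..n}"
          then show "x i < x j \<longleftrightarrow> K2 (b \<circ> x) i < K2 (b \<circ> x) j"
            using lt[of i j] lt[of j i] injD[OF permutes_inj[OF x], of i j]
            by (cases "x i" "x j" rule: linorder_cases) auto
        qed
      next
        assume ?R
        then show ?L by (auto simp: K2_def)
      qed
      also have "\<dots> \<longleftrightarrow> x \<in> X K2" using that by (simp add: X_def)
      finally show ?thesis .
    qed
    have inv: "inv x \<in> perms n" "inv (inv x) = x" if "x \<in> perms n" for x
      using that by (auto simp: perms_def permutes_inv permutes_inv_inv)
    have "X K2 \<subseteq> perms n" by (auto simp: X_def)
    then show "\<forall>x\<in>X K2. inv (inv x) = x" "inv ` X K2 \<subseteq> ?B"
      using inv(2) inv_iff by blast+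
    show "\<forall>\<sigma>\<in>?B. inv (inv \<sigma>) = \<sigma>" using inv(2) by blast
    show "inv ` ?B \<subseteq> X K2"
    proof
      fix x assume "x \<in> inv ` ?B"
      then obtain \<sigma> where "\<sigma> \<in> ?B" "x = inv \<sigma>" by blast
      then show "x \<in> X K2" using inv_iff[of x] inv[of \<sigma>] by auto
    qed
  qed
  finally have "card (X K1) = card ?B" .
  moreover have "card ?A = card (X K1)"
  proof (rule bij_betw_same_card)
    have iff: "\<pi> \<in> ?A \<longleftrightarrow> trajectory n \<pi> \<in> X K1" if \<pi>: "\<pi> \<in> cyclic_perms (Suc n)" for \<pi>
    proof -
      define x where "x = trajectory n \<pi>"
      have x: "x permutes {1..n}" unfolding x_def by (rule trajectory_permutes[OF \<pi>])
      have inj: "inj_on \<pi> {1..n}"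
        using \<pi> by (auto simp: cyclic_perms_def perms_def intro: permutes_inj_on)
      have "descent_set (Suc n) \<pi> \<inter> {1..n - 1} = {i \<in> {1..n - 1}. \<pi> i > \<pi> (i + 1)}"
        by (auto simp: descent_set_def)
      then have "\<pi> \<in> ?A \<longleftrightarrow> {i \<in> {1..n - 1}. \<pi> i > \<pi> (i + 1)} \<subseteq> S" using \<pi> by simp
      \<comment> \<open>The same substitution now uses that \<open>\<pi>\<close> advances the
        trajectory by one index, which yields the left side of
        \<open>suffix_order_iff\<close>.\<close>
      also have "\<dots> \<longleftrightarrow> (\<forall>p\<in>x ` {1..n}. \<forall>q\<in>x ` {1..n}. p < q \<longrightarrow> b p = b q \<longrightarrow> \<pi> p < \<pi> q)"
        unfolding permutes_image[OF x] by (rule nd[OF inj])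
      also have "\<dots> \<longleftrightarrow> (\<forall>i\<in>{1..n}. \<forall>j\<in>{1..n}. x i < x j \<longrightarrow> (b \<circ> x) i = (b \<circ> x) j \<longrightarrow> x (Suc i) < x (Suc j))"
        using trajectory_step[OF \<pi>] by (simp add: x_def)
      also have "\<dots> \<longleftrightarrow> (\<forall>i\<in>{1..n}. \<forall>j\<in>{1..n}. x i < x j \<longleftrightarrow> K1 (b \<circ> x) i < K1 (b \<circ> x) j)"
        unfolding K1_def
      proof (rule suffix_order_iff[OF x])
        fix i assume "i \<in> {1..n}"
        then have "x i \<in> {1..n}" using permutes_in_image[OF x] by blast
        then show "(b \<circ> x) i < (b \<circ> x) (Suc n)"
          using b_max permutes_not_in[OF x, of "Suc n"] by simp
      qed (auto intro: b_mono)
      also have "\<dots> \<longleftrightarrow> x \<in> X K1" using x by (simp add: X_def perms_def)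
      finally show ?thesis by (simp add: x_def)
    qed
    have "trajectory n ` ?A = X K1"
    proof (intro equalityI subsetI)
      fix x assume "x \<in> trajectory n ` ?A"
      then obtain \<pi> where "\<pi> \<in> ?A" "x = trajectory n \<pi>" by (rule imageE)
      then show "x \<in> X K1" using iff[of \<pi>] by simp
    next
      fix x assume x: "x \<in> X K1"
      then have "x \<in> trajectory n ` cyclic_perms (Suc n)"
        using bij_betw_imp_surj_on[OF bij_betw_trajectory[OF n]] by (simp add: X_def)
      then obtain \<pi> where "\<pi> \<in> cyclic_perms (Suc n)" "x = trajectory n \<pi>" by (rule imageE)
      then show "x \<in> trajectory n ` ?A" using iff[of \<pi>] x by (intro image_eqI) auto
    qed
    then show "bij_betw (trajectory n) ?A (X K1)"
      by (intro bij_betw_subset[OF bij_betw_trajectory[OF n]]) simp_all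
  qed
  ultimately show ?thesis by simp
qed

theorem theorem2p1:
  fixes n :: nat
  assumes "n \<ge> 1"
  shows "\<exists>\<phi>. bij_betw \<phi> (cyclic_perms (n + 1)) (perms n) \<and>
    (\<forall>\<pi> \<in> cyclic_perms (n + 1). \<forall>\<sigma>. \<sigma> = \<phi> \<pi> \<longrightarrow>
       descent_set (n + 1) \<pi> \<inter> {1..n - 1} = descent_set n \<sigma>)"
proof -
  let ?f = "\<lambda>\<pi>. descent_set (n + 1) \<pi> \<inter> {1..n - 1}"
  have fin: "finite (perms m)" for m by (simp add: perms_def finite_permutations)
  then have fin': "finite (cyclic_perms (n + 1))" by (simp add: cyclic_perms_def)
  have "card {\<pi> \<in> cyclic_perms (n + 1). ?f \<pi> = S} = card {\<sigma> \<in> perms n. descent_set n \<sigma> = S}" for S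
  proof (cases "S \<subseteq> {1..n - 1}")
    case True
    then show ?thesis
      using assms fin fin' card_descents_subset_eq
      by (intro card_fiber_eq_if_card_subset_eq) (auto intro: finite_subset)
  next
    \<comment> \<open>Both restricted descent sets lie in \<open>{1..n - 1}\<close>, so both fibres
      are empty.\<close>
    case False
    then have "{\<pi> \<in> cyclic_perms (n + 1). ?f \<pi> = S} = {}" "{\<sigma> \<in> perms n. descent_set n \<sigma> = S} = {}"
      by (auto simp: descent_set_def)
    then show ?thesis by (simp only: card.empty)
  qed
  then obtain \<phi> where "bij_betw \<phi> (cyclic_perms (n + 1)) (perms n)"
    "\<forall>\<pi>\<in>cyclic_perms (n + 1). descent_set n (\<phi> \<pi>) = ?f \<pi>"
    using bij_betw_fibers[OF fin' fin[of n], of ?f "descent_set n"] by auto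
  then show ?thesis by auto
qed

end
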